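(* There exists a stationary generalized Bratteli diagram together with a (non-stationary) order such that both the set $X_{\min}$ of infinite minimal paths and the set $X_{\max}$ of infinite maximal paths have the cardinality of the continuum.
   Context: A generalized Bratteli diagram is an infinite graded graph $B=(V,E)$ with $V=\bigsqcup_{n\ge0}V_n$, $E=\bigsqcup_{n\ge0}E_n$, with range and source maps $r,s$ satisfying $r(E_n)=V_{n+1}$, $s(E_n)=V_n$, such that each $V_n$ is countably infinite, each $E_n$ is countable, and $|r^{-1}(v)|<\infty$ for every $v\in V\setminus V_0$. Its $n$-th incidence matrix $F_n=(f^{(n)}_{v,w})$, $v\in V_{n+1}$, $w\in V_n$, counts the edges from $w$ to $v$; the diagram is stationary if all the sets $V_n$ are identified with one index set and $F_n=F$ for all $n$. An order on $B$ is a partial order on $E$ in which edges $e,e'$ are comparable if and only if $r(e)=r(e')$, i.e. a linear order on each finite set $r^{-1}(v)$, $v\in V\setminus V_0$. An order on a stationary diagram is stationary if for each index $v$ the linearly ordered list of sources of the edges in $r^{-1}(v)$, $v\in V_{n+1}$, is the same for all $n\ge0$, and non-stationary otherwise. An infinite path $(e_0,e_1,\dots)$ starting at $V_0$ is minimal (respectively maximal) if each $e_n$ is minimal (respectively maximal) in $r^{-1}(r(e_n))$. *)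

theory Defs
  imports Complex_Main "HOL-Library.Equipollence" "HOL-Library.Countable_Set" "HOL-Library.Disjoint_Sets"
begin

record ('v, 'e) graded_graph =
  verts :: "nat \<Rightarrow> 'v set"
  edges :: "nat \<Rightarrow> 'e set"
  rng :: "'e \<Rightarrow> 'v"
  src :: "'e \<Rightarrow> 'v"

definition all_edges :: "('v, 'e) graded_graph \<Rightarrow> 'e set" where
  "all_edges B = (\<Union>n. edges B n)"

definition edges_into :: "('v, 'e) graded_graph \<Rightarrow> 'v \<Rightarrow> 'e set" where
  "edges_into B v = {e \<in> all_edges B. rng B e = v}"

text \<open>In the finiteness clause, \<open>(\<Union>n. verts B n) - verts B 0\<close> is the set of all
  vertices that are not on the initial level.\<close>

definition generalized_bratteli_diagram :: "('v, 'e) graded_graph \<Rightarrow> bool" where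
  "generalized_bratteli_diagram B \<longleftrightarrow>
     disjoint_family (verts B) \<and> disjoint_family (edges B) \<and>
     (\<forall>n. rng B ` edges B n = verts B (Suc n)) \<and>
     (\<forall>n. src B ` edges B n = verts B n) \<and>
     (\<forall>n. countable (verts B n) \<and> infinite (verts B n)) \<and>
     (\<forall>n. countable (edges B n)) \<and>
     (\<forall>v \<in> (\<Union>n. verts B n) - verts B 0. finite (edges_into B v))"

definition incidence :: "('v, 'e) graded_graph \<Rightarrow> nat \<Rightarrow> 'v \<Rightarrow> 'v \<Rightarrow> nat" where
  "incidence B n v w = card {e \<in> edges B n. src B e = w \<and> rng B e = v}"

text \<open>The index set is the whole type \<open>'i\<close>; \<open>\<iota> n\<close> is the identification of \<open>'i\<close> with the
  \<open>n\<close>-th level. It is a parameter because stationarity of an order refers to the same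
  identification.\<close>

definition stationary_diagram ::
  "('v, 'e) graded_graph \<Rightarrow> (nat \<Rightarrow> 'i \<Rightarrow> 'v) \<Rightarrow> bool" where
  "stationary_diagram B \<iota> \<longleftrightarrow>
     (\<forall>n. bij_betw (\<iota> n) UNIV (verts B n)) \<and>
     (\<exists>F :: 'i \<Rightarrow> 'i \<Rightarrow> nat. \<forall>n v w. incidence B n (\<iota> (Suc n) v) (\<iota> n w) = F v w)"

text \<open>\<open>(e, e') \<in> R\<close> means that \<open>e\<close> is less than or equal to \<open>e'\<close>.\<close>

definition diagram_order :: "('v, 'e) graded_graph \<Rightarrow> 'e rel \<Rightarrow> bool" where
  "diagram_order B R \<longleftrightarrow>
     partial_order_on (all_edges B) R \<and>
     (\<forall>e \<in> all_edges B. \<forall>e' \<in> all_edges B.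
        ((e, e') \<in> R \<or> (e', e) \<in> R) \<longleftrightarrow> rng B e = rng B e')"

text \<open>The list \<open>es\<close> enumerates the finite linearly ordered set of edges into \<open>\<iota> (Suc n) v\<close>
  increasingly; \<open>ws\<close> is its list of sources, read through the identification and
  independent of \<open>n\<close>.\<close>

definition stationary_order ::
  "('v, 'e) graded_graph \<Rightarrow> (nat \<Rightarrow> 'i \<Rightarrow> 'v) \<Rightarrow> 'e rel \<Rightarrow> bool" where
  "stationary_order B \<iota> R \<longleftrightarrow>
     (\<forall>v. \<exists>ws :: 'i list. \<forall>n. \<exists>es.
        distinct es \<and> set es = edges_into B (\<iota> (Suc n) v) \<and>
        sorted_wrt (\<lambda>e e'. (e, e') \<in> R) es \<and>
        map (src B) es = map (\<iota> n) ws)"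

definition infinite_paths :: "('v, 'e) graded_graph \<Rightarrow> (nat \<Rightarrow> 'e) set" where
  "infinite_paths B =
     {p. \<forall>n. p n \<in> edges B n \<and> rng B (p n) = src B (p (Suc n))}"

definition minimal_edge :: "('v, 'e) graded_graph \<Rightarrow> 'e rel \<Rightarrow> 'e \<Rightarrow> bool" where
  "minimal_edge B R e \<longleftrightarrow> (\<forall>e' \<in> edges_into B (rng B e). (e', e) \<in> R \<longrightarrow> e' = e)"

definition maximal_edge :: "('v, 'e) graded_graph \<Rightarrow> 'e rel \<Rightarrow> 'e \<Rightarrow> bool" where
  "maximal_edge B R e \<longleftrightarrow> (\<forall>e' \<in> edges_into B (rng B e). (e, e') \<in> R \<longrightarrow> e' = e)"

definition X_min :: "('v, 'e) graded_graph \<Rightarrow> 'e rel \<Rightarrow> (nat \<Rightarrow> 'e) set" where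
  "X_min B R = {p \<in> infinite_paths B. \<forall>n. minimal_edge B R (p n)}"

definition X_max :: "('v, 'e) graded_graph \<Rightarrow> 'e rel \<Rightarrow> (nat \<Rightarrow> 'e) set" where
  "X_max B R = {p \<in> infinite_paths B. \<forall>n. maximal_edge B R (p n)}"

end

theory Submission
  imports Defs "HOL-Analysis.Abstract_Topology_2"
begin

text \<open>
  In an ordered diagram every vertex beyond level 0 has exactly one minimal incoming edge.
  Sending a vertex to the source of that edge gives maps from each level to the one before,
  and the minimal paths are the points of the inverse limit of these maps; likewise for maximal
  paths. An inverse limit of a sequence of nonempty countable sets has at most the cardinality of
  the continuum, and it reaches this bound as soon as every fibre of every map has two points,
  because a binary choice is then free at each level (lemma
  \<open>threads_eqpoll_real\<close>). So it suffices that the source maps of the extremal edges are at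
  least two-to-one.

  The diagram used here has the natural numbers on each level, and two edges into each vertex
  \<open>v\<close>: one from \<open>v div 2\<close> and one from \<open>v div 3\<close>. Both maps are at least two-to-one on the
  naturals, so whichever edge is declared minimal, the requirement is met for both
  extremes. Declaring the edge from \<open>v div 2\<close> the smaller one on even levels and the larger one
  on odd levels makes the order non-stationary, since \<open>v div 2\<close> and \<open>v div 3\<close> differ for
  \<open>v = 2\<close>.
\<close>

section \<open>Inverse limits of at least two-to-one maps\<close>

definition threads :: "(nat \<Rightarrow> 'a \<Rightarrow> 'a) \<Rightarrow> (nat \<Rightarrow> 'a) set" where
  "threads f = {x. \<forall>n. f n (x (Suc n)) = x n}"

text \<open>
  Upper bound: a thread is a sequence, which is determined by its graph, a subset of a countable
  set. Lower bound: starting from any point, a set \<open>S\<close> of naturals steers the choice between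
  two chosen preimages at each step and can be read off from the resulting thread.
\<close>
lemma threads_eqpoll_real:
  fixes f :: "nat \<Rightarrow> 'a::countable \<Rightarrow> 'a"
  assumes two: "\<And>n x. \<exists>y z. y \<noteq> z \<and> f n y = x \<and> f n z = x"
  shows "threads f \<approx> (UNIV :: real set)"
proof -
  have "threads f \<approx> (UNIV :: nat set set)"
  proof (rule lepoll_antisym)
    show "threads f \<lesssim> (UNIV :: nat set set)"
      unfolding lepoll_def
    proof (intro exI conjI)
      show "inj_on (\<lambda>x. range (\<lambda>n. to_nat (n, x n))) (threads f)"
      proof (rule inj_onI, rule ext)
        fix x y :: "nat \<Rightarrow> 'a" and n
        assume "range (\<lambda>n. to_nat (n, x n)) = range (\<lambda>n. to_nat (n, y n))"
        then have "to_nat (n, x n) \<in> range (\<lambda>n. to_nat (n, y n))"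
          by blast
        then show "x n = y n"
          by auto
      qed
    qed auto
  next
    have "\<exists>g :: bool \<Rightarrow> 'a. inj g \<and> (\<forall>b. f n (g b) = x)" for n x
    proof -
      obtain y z where "y \<noteq> z" "f n y = x" "f n z = x"
        using two by blast
      then show ?thesis
        by (intro exI[of _ "\<lambda>b. if b then y else z"]) (auto simp: inj_def)
    qed
    then obtain g :: "nat \<Rightarrow> 'a \<Rightarrow> bool \<Rightarrow> 'a"
      where inj: "\<And>n x. inj (g n x)" and g: "\<And>n x b. f n (g n x b) = x"
      by metis
    define t where "t S = rec_nat undefined (\<lambda>n x. g n x (n \<in> S))" for S :: "nat set"
    have t_Suc: "t S (Suc n) = g n (t S n) (n \<in> S)" for S n
      by (simp add: t_def)
    show "(UNIV :: nat set set) \<lesssim> threads f"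
      unfolding lepoll_def
    proof (intro exI conjI)
      show "inj t"
      proof (rule injI, rule set_eqI)
        fix S T n
        assume "t S = t T"
        then have "g n (t T n) (n \<in> S) = g n (t T n) (n \<in> T)"
          using t_Suc by metis
        then show "n \<in> S \<longleftrightarrow> n \<in> T"
          using inj by (simp add: inj_eq)
      qed
      show "range t \<subseteq> threads f"
        by (auto simp: threads_def t_Suc g)
    qed
  qed
  then show ?thesis
    using nat_sets_eqpoll_reals by (rule eqpoll_trans)
qed

section \<open>The diagram\<close>

text \<open>
  The edge \<open>(n, k)\<close> leads from level \<open>n\<close> into the vertex \<open>v = k div 2\<close> of level \<open>Suc n\<close>. The
  parity of \<open>k\<close> distinguishes the two edges into \<open>v\<close>: an even \<open>k\<close> has source \<open>v div 2\<close>, an odd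
  one \<open>v div 3\<close>.
\<close>
definition div_diagram :: "(nat \<times> nat, nat \<times> nat) graded_graph" where
  "div_diagram =
     \<lparr>verts = \<lambda>n. {n} \<times> UNIV,
      edges = \<lambda>n. {n} \<times> UNIV,
      rng = \<lambda>(n, k). (Suc n, k div 2),
      src = \<lambda>(n, k). (n, k div 2 div (2 + k mod 2))\<rparr>"

definition alternating_order :: "(nat \<times> nat) rel" where
  "alternating_order =
     {((n, k), (n', l)). n = n' \<and> k div 2 = l div 2 \<and> (if even n then k \<le> l else l \<le> k)}"

lemma div_diagram_simps [simp]:
  "verts div_diagram n = {n} \<times> UNIV"
  "edges div_diagram n = {n} \<times> UNIV"
  "rng div_diagram (n, k) = (Suc n, k div 2)"
  "src div_diagram (n, k) = (n, k div 2 div (2 + k mod 2))"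
  by (simp_all add: div_diagram_def)

lemma all_edges_div_diagram [simp]: "all_edges div_diagram = UNIV"
  by (auto simp: all_edges_def)

lemma div_2_eq_iff: "k div 2 = v \<longleftrightarrow> k = 2 * v \<or> k = Suc (2 * v)" for k v :: nat
  by presburger

lemma edges_into_div_diagram:
  "edges_into div_diagram (Suc n, v) = {(n, 2 * v), (n, Suc (2 * v))}"
  by (auto simp: edges_into_def div_2_eq_iff)

lemma generalized_bratteli_div_diagram: "generalized_bratteli_diagram div_diagram"
  unfolding generalized_bratteli_diagram_def
proof (intro conjI allI ballI)
  fix n
  show "rng div_diagram ` edges div_diagram n = verts div_diagram (Suc n)"
  proof -
    have "(Suc n, v) \<in> rng div_diagram ` edges div_diagram n" for v
      by (rule image_eqI[of _ _ "(n, 2 * v)"]) auto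
    then have "verts div_diagram (Suc n) \<subseteq> rng div_diagram ` edges div_diagram n"
      by (simp only: div_diagram_simps) blast
    then show ?thesis
      by (intro subset_antisym) auto
  qed
  show "src div_diagram ` edges div_diagram n = verts div_diagram n"
  proof -
    (* the even edge into the vertex 2 * w has source w *)
    have "(n, w) \<in> src div_diagram ` edges div_diagram n" for w
      by (rule image_eqI[of _ _ "(n, 4 * w)"]) auto
    then have "verts div_diagram n \<subseteq> src div_diagram ` edges div_diagram n"
      by (simp only: div_diagram_simps) blast
    then show ?thesis
      by (intro subset_antisym) auto
  qed
  show "infinite (verts div_diagram n)"
    by (simp add: finite_cartesian_product_iff)
next
  fix v
  assume "v \<in> (\<Union>n. verts div_diagram n) - verts div_diagram 0"
  then obtain n w where "v = (Suc n, w)"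
    by (cases v; cases "fst v") auto
  then show "finite (edges_into div_diagram v)"
    by (simp add: edges_into_div_diagram)
qed (auto simp: disjoint_family_on_def)

lemma stationary_div_diagram: "stationary_diagram div_diagram Pair"
  unfolding stationary_diagram_def
proof (intro conjI exI allI)
  fix n
  show "bij_betw (Pair n) UNIV (verts div_diagram n)"
    by (auto simp: bij_betw_def inj_on_def)
  fix v w :: nat
  let ?K = "{k. k div 2 div (2 + k mod 2) = w \<and> k div 2 = v}"
  have "{e \<in> edges div_diagram n. src div_diagram e = (n, w) \<and> rng div_diagram e = (Suc n, v)}
      = Pair n ` ?K"
    by auto
  then show "incidence div_diagram n (Suc n, v) (n, w) = card ?K"
    by (simp add: incidence_def card_image inj_on_def)
qed

lemma diagram_order_alternating: "diagram_order div_diagram alternating_order"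
  unfolding diagram_order_def
proof (intro conjI ballI)
  show "partial_order_on (all_edges div_diagram) alternating_order"
    by (auto simp: partial_order_on_def preorder_on_def refl_on_def trans_def antisym_def
        alternating_order_def split: if_splits)
next
  fix e e' :: "nat \<times> nat"
  show "(e, e') \<in> alternating_order \<or> (e', e) \<in> alternating_order \<longleftrightarrow>
      rng div_diagram e = rng div_diagram e'"
    by (cases e; cases e') (auto simp: alternating_order_def)
qed

text \<open>
  The two edges into the vertex 2 have the distinct sources 1 and 0, and they are listed in
  opposite orders on the levels 0 and 1.
\<close>
lemma not_stationary_alternating: "\<not> stationary_order div_diagram Pair alternating_order"
proof
  assume "stationary_order div_diagram Pair alternating_order"
  then obtain ws where ws: "\<And>n. \<exists>es. distinct es \<and> set es = edges_into div_diagram (Suc n, 2) \<and>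
      sorted_wrt (\<lambda>e e'. (e, e') \<in> alternating_order) es \<and>
      map (src div_diagram) es = map (Pair n) ws"
    unfolding stationary_order_def by metis
  have two: "es = [a, b] \<or> es = [b, a]" if "distinct es" "set es = {a, b}" "a \<noteq> b"
    for es :: "(nat \<times> nat) list" and a b
  proof -
    have "length es = 2"
      using that distinct_card[OF that(1)] by simp
    then obtain c d where "es = [c, d]"
      by (auto simp: numeral_2_eq_2 length_Suc_conv)
    with that show ?thesis
      by (auto simp: doubleton_eq_iff)
  qed
  obtain es where es: "distinct es" "set es = {(0, 4), (0, 5)}"
      "sorted_wrt (\<lambda>e e'. (e, e') \<in> alternating_order) es"
      "map (src div_diagram) es = map (Pair 0) ws"
    using ws[of 0] by (auto simp: edges_into_div_diagram)
  have "es = [(0, 4), (0, 5)]"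
    using two[OF es(1,2)] es(3) by (auto simp: alternating_order_def)
  with es(4) have "ws = [1, 0]"
    by auto
  obtain es' where es': "distinct es'" "set es' = {(1, 4), (1, 5)}"
      "sorted_wrt (\<lambda>e e'. (e, e') \<in> alternating_order) es'"
      "map (src div_diagram) es' = map (Pair 1) ws"
    using ws[of 1] by (auto simp: edges_into_div_diagram)
  have "es' = [(1, 5), (1, 4)]"
    using two[OF es'(1,2)] es'(3) by (auto simp: alternating_order_def)
  with es'(4) have "ws = [0, 1]"
    by auto
  with \<open>ws = [1, 0]\<close> show False
    by simp
qed

section \<open>Extremal paths\<close>

lemma minimal_edge_iff:
  "minimal_edge div_diagram alternating_order (n, k) \<longleftrightarrow> even (n + k)"
  by (cases "even k"; elim evenE oddE)
    (auto simp: minimal_edge_def edges_into_div_diagram alternating_order_def)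

lemma maximal_edge_iff:
  "maximal_edge div_diagram alternating_order (n, k) \<longleftrightarrow> odd (n + k)"
  by (cases "even k"; elim evenE oddE)
    (auto simp: maximal_edge_def edges_into_div_diagram alternating_order_def)

text \<open>
  The offset \<open>q\<close> treats minimal paths (\<open>q = 0\<close>) and maximal paths (\<open>q = 1\<close>) at once. The parity
  condition leaves one edge into each vertex, so a path is determined by the vertices it visits,
  and these form a thread of division maps with alternating divisors 2 and 3.
\<close>
lemma parity_paths_eqpoll_real:
  "{p \<in> infinite_paths div_diagram. \<forall>n. even (n + q + snd (p n))} \<approx> (UNIV :: real set)"
    (is "?P \<approx> _")
proof -
  define f :: "nat \<Rightarrow> nat \<Rightarrow> nat" where "f n x = x div (2 + (n + q) mod 2)" for n x
  define path where "path v n = (n, 2 * v (Suc n) + (n + q) mod 2)" for v :: "nat \<Rightarrow> nat" and n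
  have div: "(d * x + r) div d = x" if "r < d" for d r x :: nat
    using that by simp
  have "\<exists>y z. y \<noteq> z \<and> f n y = x \<and> f n z = x" for n x
  proof (intro exI conjI)
    let ?d = "2 + (n + q) mod 2"
    show "?d * x + 0 \<noteq> ?d * x + 1"
      by simp
    show "f n (?d * x + 0) = x" "f n (?d * x + 1) = x"
      using div[of 0 ?d x] div[of 1 ?d x] unfolding f_def by simp_all
  qed
  then have "threads f \<approx> (UNIV :: real set)"
    by (rule threads_eqpoll_real)
  moreover have "bij_betw path (threads f) ?P"
    unfolding bij_betw_def
  proof (intro conjI subset_antisym)
    show "inj_on path (threads f)"
    proof (rule inj_onI, rule ext)
      fix v w n
      assume vw: "v \<in> threads f" "w \<in> threads f" "path v = path w"
      then have "v (Suc n) = w (Suc n)"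
        by (simp add: path_def fun_eq_iff)
      (* entry 0, which path does not record, is the image of entry 1 *)
      moreover have "v n = f n (v (Suc n))" "w n = f n (w (Suc n))"
        using vw(1,2) by (simp_all add: threads_def)
      ultimately show "v n = w n"
        by simp
    qed
    have "rng div_diagram (path v n) = (Suc n, v (Suc n))"
      "src div_diagram (path v n) = (n, f n (v (Suc n)))" for v n
      by (simp_all add: path_def f_def)
    then show "path ` threads f \<subseteq> ?P"
      by (auto simp: infinite_paths_def threads_def) (simp_all add: path_def)
    show "?P \<subseteq> path ` threads f"
    proof
      fix p
      assume p: "p \<in> ?P"
      define v where "v n = snd (src div_diagram (p n))" for n
      define k where "k n = snd (p n)" for n
      have p_eq: "p n = (n, k n)" for n
        using p by (auto simp: infinite_paths_def k_def prod_eq_iff)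
      have "v (Suc n) = snd (rng div_diagram (p n))" for n
        using p by (simp add: v_def infinite_paths_def)
      then have v_Suc: "v (Suc n) = k n div 2" for n
        using p_eq[of n] by simp
      have parity: "k n mod 2 = (n + q) mod 2" for n
      proof -
        have "even (n + q + k n)"
          using p by (simp add: k_def)
        then show ?thesis
          by presburger
      qed
      have "path v n = p n" for n
        using div_mult_mod_eq[of "k n" 2] by (simp add: path_def p_eq v_Suc parity[symmetric])
      moreover have "f n (v (Suc n)) = v n" for n
        unfolding f_def v_Suc by (simp add: v_def p_eq parity)
      ultimately show "p \<in> path ` threads f"
        by (intro image_eqI[of _ _ v]) (auto simp: threads_def)
    qed
  qed
  ultimately show ?thesis
    by (meson eqpoll_def eqpoll_sym eqpoll_trans)
qed

lemma infinite_path_edge: "p \<in> infinite_paths div_diagram \<Longrightarrow> p n = (n, snd (p n))"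
  by (auto simp: infinite_paths_def prod_eq_iff)

lemma X_min_eqpoll_real: "X_min div_diagram alternating_order \<approx> (UNIV :: real set)"
proof -
  have "minimal_edge div_diagram alternating_order (p n) \<longleftrightarrow> even (n + 0 + snd (p n))"
    if "p \<in> infinite_paths div_diagram" for p n
    using minimal_edge_iff[of n "snd (p n)"] infinite_path_edge[OF that, of n] by simp
  then have "X_min div_diagram alternating_order =
      {p \<in> infinite_paths div_diagram. \<forall>n. even (n + 0 + snd (p n))}"
    unfolding X_min_def by blast
  then show ?thesis
    using parity_paths_eqpoll_real[of 0] by simp
qed

lemma X_max_eqpoll_real: "X_max div_diagram alternating_order \<approx> (UNIV :: real set)"
proof -
  have "maximal_edge div_diagram alternating_order (p n) \<longleftrightarrow> even (n + 1 + snd (p n))"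
    if "p \<in> infinite_paths div_diagram" for p n
    using maximal_edge_iff[of n "snd (p n)"] infinite_path_edge[OF that, of n] by simp
  then have "X_max div_diagram alternating_order =
      {p \<in> infinite_paths div_diagram. \<forall>n. even (n + 1 + snd (p n))}"
    unfolding X_max_def by blast
  then show ?thesis
    using parity_paths_eqpoll_real[of 1] by simp
qed

theorem corollary5p4:
  "\<exists>(B :: (nat \<times> nat, nat \<times> nat) graded_graph) (\<iota> :: nat \<Rightarrow> nat \<Rightarrow> nat \<times> nat) R.
     generalized_bratteli_diagram B \<and> stationary_diagram B \<iota> \<and>
     diagram_order B R \<and> \<not> stationary_order B \<iota> R \<and>
     X_min B R \<approx> (UNIV :: real set) \<and> X_max B R \<approx> (UNIV :: real set)"
  using generalized_bratteli_div_diagram stationary_div_diagram diagram_order_alternating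
    not_stationary_alternating X_min_eqpoll_real X_max_eqpoll_real
  by blast

end
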